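(* For every positive integer $n$, $$\operatorname{bdim}(\mathcal{M}_n) = \dim(\mathcal{M}_n) = n.$$
   Context: A poset $P=(X,\leq)$ is a non-empty (possibly infinite) set $X$ (the ground set) with a reflexive, antisymmetric and transitive relation $\leq$. A linear order is a poset in which any two elements are comparable. For a linear order $L$ and elements $x,y$ of $L$, let $[x \leq_L y] \in \{0,1\}$ be $1$ if $x \leq y$ in $L$ and $0$ otherwise. For linear orders $L_1,\dots,L_d$ on the same ground set, write $[x \leq_{L_i} y]_{i=1}^d = ([x\leq_{L_1} y],\dots,[x \leq_{L_d} y]) \in \{0,1\}^d$. Boolean dimension: let $P$ be a poset with at least two elements and $d$ a nonnegative integer. A pair $((L_1,\dots,L_d),\phi)$, where $L_1,\dots,L_d$ are (arbitrary) linear orders on the ground set of $P$ and $\phi:\{0,1\}^d\to\{0,1\}$ is any map, is a Boolean realizer of $P$ of size $d$ if for every pair of elements $x,y$ of $P$: $x \leq y$ in $P$ if and only if $\phi([x\leq_{L_i} y]_{i=1}^d)=1$. The Boolean dimension $\operatorname{bdim}(P)$ is the minimum size of a Boolean realizer of $P$. The dimension $\dim(P)$ is the minimum size of a Boolean realizer of $P$ in which $\phi$ is fixed to be $\phi(\varepsilon_1,\dots,\varepsilon_d)=\varepsilon_1\cdots\varepsilon_d$. For a positive integer $n$, $[n]=\{1,\dots,n\}$ and $\mathcal{M}_n$ is the (infinite) poset of all multisets with elements in $[n]$, with arbitrary finite multiplicities, ordered by inclusion; equivalently, $\mathcal{M}_n$ is $\{0,1,2,\dots\}^n$ with the coordinatewise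 order. *)

theory Defs
  imports "HOL-Library.Multiset" "HOL-Library.Extended_Nat"
begin

text \<open>
  A poset is given by a ground set \<open>X\<close> and an order relation \<open>r\<close> with \<open>partial_order_on X r\<close>.
  Vectors in \<open>{0,1}^d\<close> are Boolean lists of length \<open>d\<close>. The map \<open>\<phi>\<close> is total on \<open>bool list\<close>, but
  only its values on lists of length \<open>length Ls\<close> matter.
\<close>

definition comparison_vector :: "'a rel list \<Rightarrow> 'a \<Rightarrow> 'a \<Rightarrow> bool list" where
  "comparison_vector Ls x y = map (\<lambda>L. (x, y) \<in> L) Ls"

definition boolean_realizer :: "'a set \<Rightarrow> 'a rel \<Rightarrow> 'a rel list \<Rightarrow> (bool list \<Rightarrow> bool) \<Rightarrow> bool" where
  "boolean_realizer X r Ls \<phi> \<longleftrightarrow>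
     (\<forall>L\<in>set Ls. linear_order_on X L) \<and>
     (\<forall>x\<in>X. \<forall>y\<in>X. (x, y) \<in> r \<longleftrightarrow> \<phi> (comparison_vector Ls x y))"

text \<open>
  The infimum of a nonempty set of \<open>enat\<close> is attained, so the following are minima; they are \<open>\<infinity>\<close>
  exactly when there is no realizer of finite size. They are meant for posets with at least two elements.
\<close>

definition bdim :: "'a set \<Rightarrow> 'a rel \<Rightarrow> enat" where
  "bdim X r = Inf {enat (length Ls) | Ls \<phi>. boolean_realizer X r Ls \<phi>}"

definition order_dim :: "'a set \<Rightarrow> 'a rel \<Rightarrow> enat" where
  "order_dim X r = Inf {enat (length Ls) | Ls. boolean_realizer X r Ls (list_all (\<lambda>\<epsilon>. \<epsilon>))}"

definition msets_on :: "nat \<Rightarrow> nat multiset set" where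
  "msets_on n = {M. set_mset M \<subseteq> {1..n}}"

definition mset_inclusion :: "nat \<Rightarrow> nat multiset rel" where
  "mset_inclusion n = {(M, N). M \<in> msets_on n \<and> N \<in> msets_on n \<and> M \<subseteq># N}"

lemma partial_order_on_mset_inclusion: "partial_order_on (msets_on n) (mset_inclusion n)"
  by (auto simp: partial_order_on_def preorder_on_def refl_on_def trans_def antisym_def
      mset_inclusion_def)

lemma msets_on_two_elements:
  assumes "n > 0"
  shows "\<exists>M\<in>msets_on n. \<exists>N\<in>msets_on n. M \<noteq> N"
  using assms by (intro bexI[of _ "{#}"] bexI[of _ "{#1#}"]) (auto simp: msets_on_def)

end

theory Submission
  imports Defs "HOL-Library.Multiset_Order"
begin

text \<open>
  The inequality \<open>dim \<le> n\<close> holds because inclusion is the intersection of \<open>n\<close> linear orders, the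
  \<open>i\<close>-th of which compares the multiplicity of \<open>i\<close> first, and \<open>bdim \<le> dim\<close> is clear. The content is
  that \<open>d < n\<close> linear orders never suffice, whatever \<open>\<phi>\<close> is (\<open>realizer_length_ge\<close>).

  Identify multisets with points of the grid \<open>\<nat>\<^sup>n\<close> and consider a generic pair of points \<open>x, y\<close> with
  \<open>x k < y k\<close> in every coordinate \<open>k\<close>. Generic means that a property of the \<open>2n\<close> numbers counts as
  true if it holds for \<open>U\<close>-most \<open>x 1\<close>, for \<open>U\<close>-most \<open>y 1\<close>, for \<open>U\<close>-most \<open>x 2\<close>, and so on, where \<open>U\<close>
  is a free ultrafilter on \<open>\<nat>\<close>; every property is then generically true or generically false, so
  each linear order has one opinion on whether \<open>x\<close> lies below \<open>y\<close>. This replaces passing to a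
  homogeneous subgrid by a product Ramsey theorem.

  Call a linear order \<open>L\<close> sensitive to \<open>j\<close> if its opinion changes when the \<open>j\<close>-th coordinates of
  \<open>x\<close> and \<open>y\<close> are exchanged. Then \<open>L\<close> is sensitive to at most one coordinate (\<open>sensitive_unique\<close>):
  a step that decreases only coordinate \<open>j\<close>, followed by a step that decreases only
  coordinate \<open>k \<noteq> j\<close>, can amount to a step that increases every coordinate, so by transitivity \<open>L\<close>
  cannot judge both steps differently from their sum. Hence if \<open>d < n\<close>, no \<open>L\<^sub>i\<close> is sensitive to some
  coordinate \<open>j\<close>, and exchanging the \<open>j\<close>-th coordinates of a suitable pair leaves all comparisons in the
  \<open>L\<^sub>i\<close> unchanged, although it turns a comparable pair \<open>x \<le> y\<close> into an incomparable one or,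
  if \<open>n = 1\<close>, reverses it.
\<close>

section \<open>Ultrafilters as self-dual quantifiers\<close>

text \<open>
  A minimal proper filter below \<open>F\<close> decides every \<open>P\<close>: otherwise it could be restricted
  to the points where \<open>P\<close> holds. Zorn's lemma gives such a filter.
\<close>

lemma ultrafilter_below:
  fixes F :: "'a filter"
  assumes "F \<noteq> bot"
  obtains U where "U \<le> F" "U \<noteq> bot" "\<And>P. eventually P U \<or> eventually (\<lambda>x. \<not> P x) U"
proof -
  define A where "A = {G. G \<le> F \<and> G \<noteq> bot}"
  have "\<exists>U\<in>A. \<forall>G\<in>A. U \<ge> G \<longrightarrow> G = U"
  proof (rule predicate_Zorn)
    show "partial_order_on A (relation_of (\<ge>) A)"
      by (rule partial_order_on_relation_ofI) auto
    fix C assume C: "C \<in> Chains (relation_of (\<ge>) A)"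
    then have CA: "C \<subseteq> A" and tot: "\<And>G H. G \<in> C \<Longrightarrow> H \<in> C \<Longrightarrow> G \<le> H \<or> H \<le> G"
      unfolding Chains_def relation_of_def by auto
    show "\<exists>u\<in>A. \<forall>G\<in>C. u \<le> G"
    proof (cases "C = {}")
      case True
      then show ?thesis using assms by (auto simp: A_def)
    next
      case False
      have "eventually P (Inf C) \<longleftrightarrow> (\<exists>G\<in>C. eventually P G)" for P
        using False tot by (intro eventually_Inf_base, simp) (metis inf.absorb1 inf.absorb2 order_refl)
      then have "Inf C \<noteq> bot"
        using CA by (auto simp: trivial_limit_def A_def)
      moreover have "Inf C \<le> F"
        using False CA by (metis A_def Inf_lower2 ex_in_conv mem_Collect_eq subsetD)
      ultimately show ?thesis
        by (auto simp: A_def intro: Inf_lower)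
    qed
  qed
  then obtain U where U: "U \<le> F" "U \<noteq> bot"
    and max: "\<And>G. G \<le> F \<Longrightarrow> G \<noteq> bot \<Longrightarrow> G \<le> U \<Longrightarrow> G = U"
    by (auto simp: A_def)
  have "eventually P U \<or> eventually (\<lambda>x. \<not> P x) U" for P
  proof (cases "inf U (principal (Collect P)) = bot")
    case True
    then show ?thesis
      by (simp add: trivial_limit_def eventually_inf_principal)
  next
    case False
    then have "inf U (principal (Collect P)) = U"
      using U by (intro max) (auto intro: le_infI1)
    moreover have "eventually P (inf U (principal (Collect P)))"
      by (simp add: eventually_inf_principal)
    ultimately show ?thesis by simp
  qed
  then show thesis using U that by blast
qed

text \<open>
  An ultrafilter is presented as a quantifier that commutes with all propositional connectives,
  because iterating such quantifiers is just nesting them; the iterates are the tensor products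
  of the ultrafilters, which are finer than their product filters.
\<close>

locale ultra_quantifier =
  fixes Q :: "('a \<Rightarrow> bool) \<Rightarrow> bool"
  assumes conj_iff: "Q (\<lambda>x. P x \<and> R x) \<longleftrightarrow> Q P \<and> Q R"
    and not_iff: "Q (\<lambda>x. \<not> P x) \<longleftrightarrow> \<not> Q P"
begin

lemma const_iff [simp]: "Q (\<lambda>_. c) \<longleftrightarrow> c"
  using conj_iff[of "\<lambda>_. c" "\<lambda>_. \<not> c"] not_iff[of "\<lambda>_. c"] not_iff[of "\<lambda>_. False"]
  by (cases c) auto

lemma imp_iff: "Q (\<lambda>x. P x \<longrightarrow> R x) \<longleftrightarrow> (Q P \<longrightarrow> Q R)"
  using not_iff[of "\<lambda>x. P x \<and> \<not> R x"] by (simp add: conj_iff not_iff)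

lemma mono: "Q P \<Longrightarrow> (\<And>x. P x \<Longrightarrow> R x) \<Longrightarrow> Q R"
  using imp_iff[of P R] by simp

lemma iff_iff: "Q (\<lambda>x. P x \<longleftrightarrow> R x) \<longleftrightarrow> (Q P \<longleftrightarrow> Q R)"
  by (auto simp: iff_conv_conj_imp conj_iff imp_iff)

lemma ball_set_iff: "Q (\<lambda>x. \<forall>y\<in>set ys. P y x) \<longleftrightarrow> (\<forall>y\<in>set ys. Q (P y))"
  by (induction ys) (auto simp: conj_iff)

lemma ex: "Q P \<Longrightarrow> \<exists>x. P x"
  using mono[of P "\<lambda>_. False"] by auto

end

lemma ultra_quantifier_eventually:
  assumes "U \<noteq> bot" "\<And>P. eventually P U \<or> eventually (\<lambda>x. \<not> P x) U"
  shows "ultra_quantifier (\<lambda>P. eventually P U)"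
proof
  show "eventually (\<lambda>x. P x \<and> R x) U \<longleftrightarrow> eventually P U \<and> eventually R U" for P R
    by (rule eventually_conj_iff)
  show "eventually (\<lambda>x. \<not> P x) U \<longleftrightarrow> \<not> eventually P U" for P
    using assms eventually_conj_iff[of P "\<lambda>x. \<not> P x" U] by (auto simp: trivial_limit_def)
qed

lemma ultra_quantifier_nest:
  assumes "ultra_quantifier Q" "ultra_quantifier R"
  shows "ultra_quantifier (\<lambda>P. Q (\<lambda>x. R (\<lambda>y. P (h x y))))"
  using assms by (simp add: ultra_quantifier_def)

section \<open>Generic pairs and triples of grid points\<close>

text \<open>
  The quantifier \<open>Q\<close> is applied to the coordinates \<open>1, \<dots>, n\<close> one after the other, with coordinate 1
  outermost. The default \<open>d\<close> fills the positions outside \<open>{1..n}\<close>.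
\<close>

primrec quantify_coords ::
  "(('a \<Rightarrow> bool) \<Rightarrow> bool) \<Rightarrow> 'a \<Rightarrow> nat \<Rightarrow> ((nat \<Rightarrow> 'a) \<Rightarrow> bool) \<Rightarrow> bool" where
  "quantify_coords Q d 0 P \<longleftrightarrow> P (\<lambda>_. d)"
| "quantify_coords Q d (Suc n) P \<longleftrightarrow> quantify_coords Q d n (\<lambda>g. Q (\<lambda>t. P (g(Suc n := t))))"

lemma ultra_quantifier_quantify_coords:
  assumes "ultra_quantifier Q"
  shows "ultra_quantifier (quantify_coords Q d n)"
proof (induction n)
  case 0
  then show ?case by (simp add: ultra_quantifier_def)
next
  case (Suc n)
  have "quantify_coords Q d (Suc n) = (\<lambda>P. quantify_coords Q d n (\<lambda>g. Q (\<lambda>t. P (g(Suc n := t)))))"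
    by (simp add: fun_eq_iff)
  then show ?case
    using ultra_quantifier_nest[OF Suc assms] by simp
qed

lemma quantify_coords_all:
  assumes Q: "ultra_quantifier Q" and R: "Q R"
  shows "quantify_coords Q d n (\<lambda>g. \<forall>k\<in>{1..n}. R (g k))"
proof (induction n)
  case 0
  then show ?case by simp
next
  case (Suc n)
  interpret ultra_quantifier Q by (fact Q)
  have "(\<forall>k\<in>{1..Suc n}. R ((g(Suc n := t)) k)) \<longleftrightarrow> (\<forall>k\<in>{1..n}. R (g k)) \<and> R t" for g t
    by (auto simp: atLeastAtMostSuc_conv)
  then show ?case
    using Suc R by (simp add: conj_iff del: fun_upd_apply)
qed

text \<open>
  Push-forward along a family of maps that may differ from coordinate to coordinate. This is what makes
  the order of quantification useful: all numbers of one coordinate are chosen consecutively, so a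
  projection can be carried out in each coordinate separately.
\<close>

lemma quantify_coords_map:
  assumes "\<And>k R. Q (\<lambda>t. R (s k t)) \<longleftrightarrow> Q' R" "\<And>k. s k d = d'"
  shows "quantify_coords Q d n (\<lambda>g. P (\<lambda>k. s k (g k))) \<longleftrightarrow> quantify_coords Q' d' n P"
proof (induction n arbitrary: P)
  case 0
  then show ?case by (simp add: assms(2))
next
  case (Suc n)
  have upd: "(\<lambda>k. s k ((g(Suc n := t)) k)) = (\<lambda>k. s k (g k))(Suc n := s (Suc n) t)" for g t
    by auto
  have "quantify_coords Q d (Suc n) (\<lambda>g. P (\<lambda>k. s k (g k)))
      \<longleftrightarrow> quantify_coords Q d n (\<lambda>g. Q' (\<lambda>t. P ((\<lambda>k. s k (g k))(Suc n := t))))"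
    using assms(1)[of "\<lambda>t. P ((\<lambda>k. s k (_ k))(Suc n := t))" "Suc n"]
    by (simp only: quantify_coords.simps upd assms(1)[of "\<lambda>t. P (_(Suc n := t))"])
  also have "\<dots> \<longleftrightarrow> quantify_coords Q' d' (Suc n) P"
    using Suc[of "\<lambda>p. Q' (\<lambda>t. P (p(Suc n := t)))"] by simp
  finally show ?case .
qed

definition grid_point :: "nat \<Rightarrow> (nat \<Rightarrow> nat) \<Rightarrow> nat multiset" where
  "grid_point n f = (\<Sum>k\<in>{1..n}. replicate_mset (f k) k)"

lemma count_grid_point: "count (grid_point n f) k = (if k \<in> {1..n} then f k else 0)"
  by (simp add: grid_point_def count_sum)

lemma grid_point_in_msets_on [simp]: "grid_point n f \<in> msets_on n"
  by (auto simp: msets_on_def count_grid_point simp flip: count_greater_zero_iff split: if_splits)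

definition related :: "nat \<Rightarrow> nat multiset rel \<Rightarrow> (nat \<Rightarrow> nat \<times> nat) \<Rightarrow> bool" where
  "related n L p \<longleftrightarrow> (grid_point n (fst \<circ> p), grid_point n (snd \<circ> p)) \<in> L"

definition flip :: "nat \<Rightarrow> (nat \<Rightarrow> 'a \<times> 'a) \<Rightarrow> nat \<Rightarrow> 'a \<times> 'a" where
  "flip j p = p(j := prod.swap (p j))"

locale free_ultrafilter =
  fixes U :: "nat filter"
  assumes free: "U \<le> at_top" and proper: "U \<noteq> bot"
    and ultra: "eventually P U \<or> eventually (\<lambda>x. \<not> P x) U"
begin

definition pair_quantifier :: "(nat \<times> nat \<Rightarrow> bool) \<Rightarrow> bool" where
  "pair_quantifier R \<longleftrightarrow> (\<forall>\<^sub>F a in U. \<forall>\<^sub>F b in U. R (a, b))"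

definition triple_quantifier :: "(nat \<times> nat \<times> nat \<Rightarrow> bool) \<Rightarrow> bool" where
  "triple_quantifier R \<longleftrightarrow> (\<forall>\<^sub>F a in U. \<forall>\<^sub>F b in U. \<forall>\<^sub>F c in U. R (a, b, c))"

lemma ultra_quantifier_U: "ultra_quantifier (\<lambda>P. eventually P U)"
  using proper ultra by (rule ultra_quantifier_eventually)

lemma ultra_quantifier_pair: "ultra_quantifier pair_quantifier"
  using ultra_quantifier_nest[OF ultra_quantifier_U ultra_quantifier_U, where h = Pair]
  by (simp add: pair_quantifier_def [abs_def])

lemma ultra_quantifier_triple: "ultra_quantifier triple_quantifier"
  using ultra_quantifier_nest[OF ultra_quantifier_U ultra_quantifier_pair, where h = Pair]
  by (simp add: pair_quantifier_def triple_quantifier_def [abs_def])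

lemma eventually_greater: "\<forall>\<^sub>F b in U. a < b"
  using eventually_gt_at_top free by (rule filter_leD[rotated])

lemma pair_increasing: "pair_quantifier (\<lambda>(a, b). a < b)"
  by (simp add: pair_quantifier_def eventually_greater)

lemma triple_increasing: "triple_quantifier (\<lambda>(a, b, c). a < b)"
  by (simp add: triple_quantifier_def eventually_greater proper)

text \<open>
  Dropping a member of a generic increasing triple removes a dummy quantifier.
\<close>

lemma triple_projections:
  "triple_quantifier (\<lambda>(a, b, c). R (a, b)) \<longleftrightarrow> pair_quantifier R"
  "triple_quantifier (\<lambda>(a, b, c). R (a, c)) \<longleftrightarrow> pair_quantifier R"
  "triple_quantifier (\<lambda>(a, b, c). R (b, c)) \<longleftrightarrow> pair_quantifier R"
  by (simp_all add: triple_quantifier_def pair_quantifier_def proper)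

abbreviation generic_pair :: "nat \<Rightarrow> ((nat \<Rightarrow> nat \<times> nat) \<Rightarrow> bool) \<Rightarrow> bool" where
  "generic_pair \<equiv> quantify_coords pair_quantifier (0, 0)"

abbreviation generic_triple :: "nat \<Rightarrow> ((nat \<Rightarrow> nat \<times> nat \<times> nat) \<Rightarrow> bool) \<Rightarrow> bool" where
  "generic_triple \<equiv> quantify_coords triple_quantifier (0, 0, 0)"

text \<open>
  Three generic points can be compared by the opinion on generic pairs alone, even if the two
  members taken from the triple differ from coordinate to coordinate.
\<close>

lemma generic_triple_projections:
  assumes "\<And>k. s k \<in> {\<lambda>(a, b, c). (a, b), \<lambda>(a, b, c). (a, c), \<lambda>(a, b, c). (b, c)}"
  shows "generic_triple n (\<lambda>g. P (\<lambda>k. s k (g k))) \<longleftrightarrow> generic_pair n P"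
proof (rule quantify_coords_map)
  show "triple_quantifier (\<lambda>t. R (s k t)) \<longleftrightarrow> pair_quantifier R" for k R
    using assms[of k] triple_projections[of R] by (auto simp: case_prod_unfold)
  show "s k (0, 0, 0) = (0, 0)" for k
    using assms[of k] by auto
qed

section \<open>A linear order is sensitive to at most one coordinate\<close>

definition sensitive :: "nat \<Rightarrow> nat multiset rel \<Rightarrow> nat \<Rightarrow> bool" where
  "sensitive n L j \<longleftrightarrow>
     (generic_pair n (related n L) \<noteq> generic_pair n (\<lambda>p. related n L (flip j p)))"

text \<open>
  From a generic triple \<open>a < b < c\<close> in every coordinate, three points \<open>x, y, z\<close> are formed whose
  coordinates are arranged as follows.

    \<^item> \<open>x = b, y = a, z = c\<close> in coordinate \<open>j\<close>
    \<^item> \<open>x = a, y = c, z = b\<close> in coordinate \<open>k\<close>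
    \<^item> \<open>x = a, y = b, z = c\<close> in all others

  So \<open>x, y\<close> is a generic pair with coordinate \<open>j\<close> exchanged, \<open>y, z\<close> is one with coordinate \<open>k\<close>
  exchanged, and \<open>x, z\<close> is one with no coordinate exchanged. If \<open>L\<close> is sensitive to both \<open>j\<close> and \<open>k\<close>,
  then it places \<open>x, y\<close> and \<open>y, z\<close> in the same way and \<open>x, z\<close> in the opposite way, against
  transitivity.
\<close>

lemma sensitive_unique:
  assumes L: "linear_order_on (msets_on n) L"
    and j: "j \<in> {1..n}" "sensitive n L j" and k: "k \<in> {1..n}" "sensitive n L k"
  shows "j = k"
proof (rule ccontr)
  assume "j \<noteq> k"
  interpret T: ultra_quantifier "generic_triple n"
    by (intro ultra_quantifier_quantify_coords ultra_quantifier_triple)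
  let ?ab = "\<lambda>(a, b, c). (a, b)" and ?ac = "\<lambda>(a, b, c). (a, c)" and ?bc = "\<lambda>(a, b, c). (b, c)"
  \<comment> \<open>\<open>s1\<close>, \<open>s2\<close>, \<open>s3\<close> pick the increasing pairs underlying \<open>(x, y)\<close>, \<open>(y, z)\<close> and \<open>(x, z)\<close>.\<close>
  define s1 :: "nat \<Rightarrow> nat \<times> nat \<times> nat \<Rightarrow> nat \<times> nat" where
    "s1 i = (if i = k then ?ac else ?ab)" for i
  define s2 :: "nat \<Rightarrow> nat \<times> nat \<times> nat \<Rightarrow> nat \<times> nat" where
    "s2 i = (if i = j then ?ac else ?bc)" for i
  define s3 :: "nat \<Rightarrow> nat \<times> nat \<times> nat \<Rightarrow> nat \<times> nat" where
    "s3 i = (if i = j then ?bc else if i = k then ?ab else ?ac)" for i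
  define x y z :: "(nat \<Rightarrow> nat \<times> nat \<times> nat) \<Rightarrow> nat multiset" where
    "x g = grid_point n (\<lambda>i. case g i of (a, b, c) \<Rightarrow> if i = j then b else a)" and
    "y g = grid_point n (\<lambda>i. case g i of (a, b, c) \<Rightarrow> if i = j then a else if i = k then c else b)" and
    "z g = grid_point n (\<lambda>i. case g i of (a, b, c) \<Rightarrow> if i = k then b else c)"
    for g
  have xy: "related n L (flip j (\<lambda>i. s1 i (g i))) \<longleftrightarrow> (x g, y g) \<in> L" for g
    unfolding related_def x_def y_def flip_def s1_def using \<open>j \<noteq> k\<close>
    by (intro arg_cong2[where f = "\<lambda>u v. (u, v) \<in> L"] arg_cong[where f = "grid_point n"] ext)
      (auto split: prod.splits)
  have yz: "related n L (flip k (\<lambda>i. s2 i (g i))) \<longleftrightarrow> (y g, z g) \<in> L" for g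
    unfolding related_def y_def z_def flip_def s2_def using \<open>j \<noteq> k\<close>
    by (intro arg_cong2[where f = "\<lambda>u v. (u, v) \<in> L"] arg_cong[where f = "grid_point n"] ext)
      (auto split: prod.splits)
  have xz: "related n L (\<lambda>i. s3 i (g i)) \<longleftrightarrow> (x g, z g) \<in> L" for g
    unfolding related_def x_def z_def s3_def using \<open>j \<noteq> k\<close>
    by (intro arg_cong2[where f = "\<lambda>u v. (u, v) \<in> L"] arg_cong[where f = "grid_point n"] ext)
      (auto split: prod.splits)
  have XY: "generic_triple n (\<lambda>g. (x g, y g) \<in> L) \<longleftrightarrow> generic_pair n (\<lambda>p. related n L (flip j p))"
    using generic_triple_projections[of s1 n "\<lambda>p. related n L (flip j p)"]
    by (simp add: xy) (simp add: s1_def)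
  have YZ: "generic_triple n (\<lambda>g. (y g, z g) \<in> L) \<longleftrightarrow> generic_pair n (\<lambda>p. related n L (flip k p))"
    using generic_triple_projections[of s2 n "\<lambda>p. related n L (flip k p)"]
    by (simp add: yz) (simp add: s2_def)
  have XZ: "generic_triple n (\<lambda>g. (x g, z g) \<in> L) \<longleftrightarrow> generic_pair n (related n L)"
    using generic_triple_projections[of s3 n "related n L"]
    by (simp add: xz) (simp add: s3_def)
  have carrier: "x g \<in> msets_on n" "y g \<in> msets_on n" "z g \<in> msets_on n" for g
    by (simp_all add: x_def y_def z_def)
  have trans: "trans L" and antisym: "antisym L" and total: "total_on (msets_on n) L"
    and refl: "refl_on (msets_on n) L"
    using L by (auto simp: order_on_defs)
  have converse: "(v, u) \<in> L" if "u \<in> msets_on n" "v \<in> msets_on n" "(u, v) \<notin> L" for u v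
    using that total refl by (metis refl_onD total_on_def)
  show False
  proof (cases "generic_triple n (\<lambda>g. (x g, z g) \<in> L)")
    case False
    then have "generic_triple n (\<lambda>g. (x g, y g) \<in> L \<and> (y g, z g) \<in> L \<and> (x g, z g) \<notin> L)"
      using j k XY YZ XZ by (simp add: sensitive_def T.conj_iff T.not_iff)
    then show False
      using T.ex transD[OF trans] by blast
  next
    case True
    \<comment> \<open>Here antisymmetry forces \<open>x = z\<close>, so the strict increase within the triples is needed.\<close>
    have "generic_triple n (\<lambda>g. \<forall>i\<in>{1..n}. case g i of (a, b, c) \<Rightarrow> a < b)"
      by (intro quantify_coords_all ultra_quantifier_triple triple_increasing)
    then have "generic_triple n (\<lambda>g. (x g, z g) \<in> L \<and> (x g, y g) \<notin> L \<and> (y g, z g) \<notin> L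
        \<and> (\<forall>i\<in>{1..n}. case g i of (a, b, c) \<Rightarrow> a < b))"
      using True j k XY YZ XZ by (simp add: sensitive_def T.conj_iff T.not_iff)
    then obtain g where g: "(x g, z g) \<in> L" "(x g, y g) \<notin> L" "(y g, z g) \<notin> L"
      and inc: "\<forall>i\<in>{1..n}. case g i of (a, b, c) \<Rightarrow> a < b"
      using T.ex by blast
    have "(z g, x g) \<in> L"
      using g converse carrier transD[OF trans] by meson
    then have "x g = z g"
      using g antisym by (auto dest: antisymD)
    then have "count (x g) k = count (z g) k"
      by simp
    moreover have "case g k of (a, b, c) \<Rightarrow> a < b"
      using inc k(1) by (rule bspec)
    ultimately show False
      using k \<open>j \<noteq> k\<close> by (auto simp: x_def z_def count_grid_point split: prod.splits)
  qed
qed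

section \<open>The lower bound\<close>

lemma realizer_length_ge:
  assumes "boolean_realizer (msets_on n) (mset_inclusion n) Ls \<phi>"
  shows "n \<le> length Ls"
proof (rule ccontr)
  assume "\<not> n \<le> length Ls"
  interpret V: ultra_quantifier "generic_pair n"
    by (intro ultra_quantifier_quantify_coords ultra_quantifier_pair)
  have lin: "\<And>L. L \<in> set Ls \<Longrightarrow> linear_order_on (msets_on n) L"
    and real: "\<And>x y. x \<in> msets_on n \<Longrightarrow> y \<in> msets_on n \<Longrightarrow>
      (x, y) \<in> mset_inclusion n \<longleftrightarrow> \<phi> (comparison_vector Ls x y)"
    using assms by (auto simp: boolean_realizer_def)
  \<comment> \<open>Distinct coordinates need distinct sensitive orders, and there are fewer than \<open>n\<close> orders.\<close>
  have "\<exists>j\<in>{1..n}. \<forall>L\<in>set Ls. \<not> sensitive n L j"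
  proof (rule ccontr)
    assume "\<not> ?thesis"
    then obtain f where f: "\<And>j. j \<in> {1..n} \<Longrightarrow> f j \<in> set Ls \<and> sensitive n (f j) j"
      by metis
    then have "inj_on f {1..n}"
      using lin by (metis inj_onI sensitive_unique)
    then have "card {1..n} \<le> card (set Ls)"
      using f by (intro card_inj_on_le) auto
    then show False
      using \<open>\<not> n \<le> length Ls\<close> card_length[of Ls] by simp
  qed
  then obtain j where j: "j \<in> {1..n}" "\<And>L. L \<in> set Ls \<Longrightarrow> \<not> sensitive n L j"
    by blast
  \<comment> \<open>Finitely many generic properties hold simultaneously for some actual pair of points.\<close>
  have "generic_pair n (\<lambda>p. (\<forall>L\<in>set Ls. related n L p \<longleftrightarrow> related n L (flip j p))
      \<and> (\<forall>k\<in>{1..n}. case p k of (a, b) \<Rightarrow> a < b))"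
  proof (rule V.conj_iff[THEN iffD2], intro conjI)
    have "\<forall>L\<in>set Ls. generic_pair n (\<lambda>p. related n L p \<longleftrightarrow> related n L (flip j p))"
      using j(2) unfolding sensitive_def V.iff_iff by blast
    then show "generic_pair n (\<lambda>p. \<forall>L\<in>set Ls. related n L p \<longleftrightarrow> related n L (flip j p))"
      by (rule V.ball_set_iff[THEN iffD2])
    show "generic_pair n (\<lambda>p. \<forall>k\<in>{1..n}. case p k of (a, b) \<Rightarrow> a < b)"
      by (intro quantify_coords_all ultra_quantifier_pair pair_increasing)
  qed
  then obtain p where same: "\<And>L. L \<in> set Ls \<Longrightarrow> related n L p \<longleftrightarrow> related n L (flip j p)"
    and inc: "\<And>k. k \<in> {1..n} \<Longrightarrow> fst (p k) < snd (p k)"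
    using V.ex by (fastforce simp: case_prod_unfold)
  let ?x = "grid_point n (fst \<circ> p)" and ?y = "grid_point n (snd \<circ> p)"
  let ?x' = "grid_point n (fst \<circ> flip j p)" and ?y' = "grid_point n (snd \<circ> flip j p)"
  have "comparison_vector Ls ?x ?y = comparison_vector Ls ?x' ?y'"
    using same by (simp add: comparison_vector_def related_def)
  then have "(?x, ?y) \<in> mset_inclusion n \<longleftrightarrow> (?x', ?y') \<in> mset_inclusion n"
    by (simp add: real)
  moreover have "(?x, ?y) \<in> mset_inclusion n"
    using inc by (auto simp: mset_inclusion_def subseteq_mset_def count_grid_point intro: less_imp_le)
  moreover have "count ?y' j < count ?x' j"
    using inc j(1) by (simp add: count_grid_point flip_def)
  then have "(?x', ?y') \<notin> mset_inclusion n"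
    by (auto simp: mset_inclusion_def subseteq_mset_def not_le)
  ultimately show False by blast
qed

end

lemma bdim_ge: "enat n \<le> bdim (msets_on n) (mset_inclusion n)"
proof -
  obtain U :: "nat filter" where "U \<le> at_top" "U \<noteq> bot"
    "\<And>P. eventually P U \<or> eventually (\<lambda>x. \<not> P x) U"
    using ultrafilter_below[of "at_top :: nat filter"] by auto
  then interpret free_ultrafilter U
    by unfold_locales
  show ?thesis
    unfolding bdim_def by (rule Inf_greatest) (use realizer_length_ge in auto)
qed

section \<open>The upper bound\<close>

text \<open>
  Ties in the multiplicity of \<open>i\<close> are broken by the multiset order on \<open>nat multiset\<close>, which is a
  linear extension of inclusion.
\<close>

definition coordinate_order :: "nat \<Rightarrow> nat \<Rightarrow> nat multiset rel" where
  "coordinate_order n i = {(M, N). M \<in> msets_on n \<and> N \<in> msets_on n \<and>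
     (count M i < count N i \<or> count M i = count N i \<and> M \<le> N)}"

lemma linear_order_coordinate_order: "linear_order_on (msets_on n) (coordinate_order n i)"
  by (auto simp: order_on_defs refl_on_def trans_def antisym_def total_on_def coordinate_order_def)

lemma inclusion_iff_coordinate_orders:
  assumes "M \<in> msets_on n" "N \<in> msets_on n"
  shows "(M, N) \<in> mset_inclusion n \<longleftrightarrow> (\<forall>i\<in>{1..n}. (M, N) \<in> coordinate_order n i)"
proof
  assume "(M, N) \<in> mset_inclusion n"
  then show "\<forall>i\<in>{1..n}. (M, N) \<in> coordinate_order n i"
    by (auto simp: mset_inclusion_def coordinate_order_def subset_eq_imp_le_multiset
        dest: mset_subset_eq_count simp: order.order_iff_strict[of "count M _"])
next
  assume *: "\<forall>i\<in>{1..n}. (M, N) \<in> coordinate_order n i"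
  have "count M i \<le> count N i" for i
  proof (cases "i \<in> {1..n}")
    case True
    then have "(M, N) \<in> coordinate_order n i" using * by blast
    then show ?thesis by (auto simp: coordinate_order_def)
  next
    case False
    then have "i \<notin># M" using assms by (auto simp: msets_on_def)
    then show ?thesis by (simp add: not_in_iff)
  qed
  then show "(M, N) \<in> mset_inclusion n"
    using assms by (simp add: mset_inclusion_def subseteq_mset_def)
qed

lemma order_dim_le: "order_dim (msets_on n) (mset_inclusion n) \<le> enat n"
proof -
  let ?Ls = "map (coordinate_order n) [1..<Suc n]"
  have "boolean_realizer (msets_on n) (mset_inclusion n) ?Ls (list_all (\<lambda>\<epsilon>. \<epsilon>))"
    by (auto simp: boolean_realizer_def linear_order_coordinate_order comparison_vector_def
        inclusion_iff_coordinate_orders list_all_iff simp del: upt_Suc)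
  moreover have "length ?Ls = n" by simp
  ultimately show ?thesis
    unfolding order_dim_def by (intro Inf_lower) (metis (mono_tags, lifting) mem_Collect_eq)
qed

lemma bdim_le_order_dim: "bdim X r \<le> order_dim X r"
  unfolding bdim_def order_dim_def by (rule Inf_superset_mono) blast

theorem theorem2:
  fixes n :: nat
  assumes "n > 0"
  shows "bdim (msets_on n) (mset_inclusion n) = order_dim (msets_on n) (mset_inclusion n)
    \<and> order_dim (msets_on n) (mset_inclusion n) = enat n"
  using bdim_ge[of n] bdim_le_order_dim[of "msets_on n" "mset_inclusion n"] order_dim_le[of n]
  by (metis order.antisym order.trans)

end
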